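(* Let $(\Psi_l,\Psi_u,\epsilon)$ be a solution of the optimization problem (P) described in the context. Then $V_u=-\lambda\log\Psi_l$ (regarded as a time-independent function of $(x,t)$) is a stochastic control Lyapunov function for the system $dx_t=(f(x_t)+G(x_t)u_t)\,dt+B(x_t)\,d\omega_t$.
   Context: Setting. $\mathbb{R}[x]$ denotes real polynomials in $x\in\mathbb{R}^n$, and $\mathbb{R}_+=[0,\infty)$. $\Omega\subset\mathbb{R}^n$ is a compact basic closed semialgebraic set, $\Omega=\{x: g_i(x)\ge 0,\ i=1,\dots,k\}$ with $g_i\in\mathbb{R}[x]$, $0\in\Omega$; its boundary is $\partial\Omega=\{x:\prod_{i=1}^m h_i(x)=0\}$ with $h_i\in\mathbb{R}[x]$; the origin is treated as part of the boundary. The system is $dx_t=(f(x_t)+G(x_t)u_t)\,dt+B(x_t)\,d\omega_t$, where $x_t\in\Omega$, $u_t$ is the (vector) control, $f,G,B$ are vector/matrix valued with entries in $\mathbb{R}[x]$, $f(0)=0$, $G(0)=0$, $B(0)=0$, and $\omega_t$ is a vector Brownian motion with covariance $\Sigma_\epsilon$ (increments $\omega_t-\omega_s\sim\mathcal N(0,\Sigma_\epsilon(t-s))$). The cost is $\mathbb{E}_{\omega_t}[J(x,u)]=\mathbb{E}_{\omega_t}\left[\phi(x_T)+\int_0^T q(x_t)+\tfrac12u_t^TRu_t\,dt\right]$, where $T$ is the first time the state reaches $\partial\Omega$ or the origin, $R$ is a positive definite matrix, and $q,\phi\in\mathbb{R}[x]$ map $\Omega\to\mathbb{R}_+$ and are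 positive definite (zero at $0$, positive on $\Omega\setminus\{0\}$). The value function is the minimal expected cost as a function of the initial state. HJB equation: $0=q+(\nabla_xV)^Tf-\tfrac12(\nabla_xV)^TGR^{-1}G^T(\nabla_xV)+\tfrac12\mathrm{Tr}\left((\nabla_{xx}V)B\Sigma_\epsilon B^T\right)$ on $\Omega$ with $V=\phi$ on $\partial\Omega$. It is assumed there is $\lambda>0$ with $\lambda G(x)R^{-1}G(x)^T=B(x)\Sigma_\epsilon B(x)^T=:\Sigma(x)$. With $V=-\lambda\log\Psi$, the HJB equation becomes the linear PDE $0=-\tfrac1\lambda q\Psi+\mathcal L(\Psi)$ on $\Omega$, $\Psi=\psi:=e^{-\phi/\lambda}$ on $\partial\Omega$, where $\mathcal L(\Psi)=f^T(\nabla_x\Psi)+\tfrac12\mathrm{Tr}((\nabla_{xx}\Psi)\Sigma)$. It is assumed that unique viscosity solutions $V^*$ and $\Psi^*$ of these two problems exist; $V^*=-\lambda\log\Psi^*$ is the value function. Problem (P): minimize $\epsilon$ over polynomials $\Psi_l,\Psi_u\in\mathbb{R}[x]$ subject to $\tfrac1\lambda q\Psi_l-\mathcal L(\Psi_l)\le 0$ on $\Omega$; $0\le\tfrac1\lambda q\Psi_u-\mathcal L(\Psi_u)$ on $\Omega$; $\Psi_u-\Psi_l\le\epsilon$ on $\Omega$; $0\le\Psi_l\le\psi\le\Psi_u$ on $\partial\Omega$; for each coordinate $i$, $\partial_{x^i}\Psi_l\le0$ at points of $\Omega$ with $x^i\ge0$ and $\partial_{x^i}\Psi_l\ge 0$ at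 points of $\Omega$ with $x^i\le 0$; and $\Psi_l(0)=1$. It is understood that $\Psi_l>0$ on $\Omega$, so that $V_u=-\lambda\log\Psi_l$ is well defined. Stochastic control Lyapunov function (SCLF). $\mathcal K$ is the set of continuous nondecreasing $\mu:\mathbb{R}_+\to\mathbb{R}_+$ with $\mu(0)=0$ and $\mu(r)>0$ for $r>0$. $\mathcal C^{2,1}$ is the set of functions twice differentiable in the first argument and once in the second. An SCLF for the system is a positive definite function $\mathcal V\in\mathcal C^{2,1}$ on $\mathcal O=(\Omega\cup\{0\})\times\{t>0\}$ such that $\mathcal V(0,t)=0$ and $\mathcal V(x,t)\ge\mu(|x|)$ for all $t$, for some $\mu\in\mathcal K$, and there exists $u(x,t)$ such that $L(\mathcal V(x,t))\le 0$ for all $(x,t)\in\mathcal O\setminus\{(0,t)\}$, where $L(\mathcal V)=\partial_t\mathcal V+\nabla_x\mathcal V^T(f+Gu)+\tfrac12\mathrm{Tr}\left((\nabla_{xx}\mathcal V)B\Sigma_\epsilon B^T\right)$. *)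

theory Defs
  imports "HOL-Probability.Probability"
begin

definition partial_deriv :: "'n \<Rightarrow> (real^'n::finite \<Rightarrow> real) \<Rightarrow> real^'n \<Rightarrow> real" where
  "partial_deriv i F x = deriv (\<lambda>s. F (x + s *\<^sub>R axis i 1)) 0"

definition gradient :: "(real^'n::finite \<Rightarrow> real) \<Rightarrow> real^'n \<Rightarrow> real^'n" where
  "gradient F x = (\<chi> i. partial_deriv i F x)"

definition hessian :: "(real^'n::finite \<Rightarrow> real) \<Rightarrow> real^'n \<Rightarrow> real^'n^'n" where
  "hessian F x = (\<chi> i j. partial_deriv i (partial_deriv j F) x)"

definition pos_semidef_matrix :: "real^'n^'n::finite \<Rightarrow> bool" where
  "pos_semidef_matrix A \<longleftrightarrow> transpose A = A \<and> (\<forall>v. 0 \<le> v \<bullet> (A *v v))"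

definition pos_def_matrix :: "real^'n^'n::finite \<Rightarrow> bool" where
  "pos_def_matrix A \<longleftrightarrow> transpose A = A \<and> (\<forall>v. v \<noteq> 0 \<longrightarrow> 0 < v \<bullet> (A *v v))"

text \<open>The law N(0, S), given by its characteristic function so that a singular covariance
  matrix S is allowed.\<close>

definition centred_gaussian ::
    "'w measure \<Rightarrow> ('w \<Rightarrow> real^'d::finite) \<Rightarrow> real^'d^'d \<Rightarrow> bool" where
  "centred_gaussian M X S \<longleftrightarrow>
     X \<in> borel_measurable M \<and> pos_semidef_matrix S \<and>
     (\<forall>a. char (distr M borel (\<lambda>w. a \<bullet> X w)) 1 = of_real (exp (- (a \<bullet> (S *v a)) / 2)))"

definition brownian_motion ::
    "'w measure \<Rightarrow> (real \<Rightarrow> 'w \<Rightarrow> real^'d::finite) \<Rightarrow> real^'d^'d \<Rightarrow> bool" where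
  "brownian_motion M W S \<longleftrightarrow>
     prob_space M \<and>
     (\<forall>t\<ge>0. W t \<in> borel_measurable M) \<and>
     (AE w in M. W 0 w = 0) \<and>
     (AE w in M. continuous_on {0..} (\<lambda>t. W t w)) \<and>
     (\<forall>s t. 0 \<le> s \<and> s \<le> t \<longrightarrow>
        centred_gaussian M (\<lambda>w. W t w - W s w) ((t - s) *\<^sub>R S)) \<and>
     (\<forall>(\<tau> :: nat \<Rightarrow> real) N. 0 \<le> \<tau> 0 \<and> mono \<tau> \<longrightarrow>
        prob_space.indep_vars M (\<lambda>_. borel) (\<lambda>k w. W (\<tau> (Suc k)) w - W (\<tau> k) w) {..<N})"

text \<open>The origin is counted as a boundary point, also when it is interior to the domain.\<close>

definition domain_boundary :: "(real^'n::finite) set \<Rightarrow> (real^'n) set" where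
  "domain_boundary \<Omega> = insert 0 (frontier \<Omega>)"

definition pos_def_on :: "(real^'n::finite) set \<Rightarrow> (real^'n \<Rightarrow> real) \<Rightarrow> bool" where
  "pos_def_on \<Omega> F \<longleftrightarrow> F 0 = 0 \<and> (\<forall>x\<in>\<Omega> - {0}. 0 < F x)"

text \<open>Here \<open>S\<close> is the covariance matrix of the noise, so that \<open>B x ** S ** transpose (B x)\<close> is the
  diffusion matrix.\<close>

definition linear_HJB_op ::
    "(real^'n::finite \<Rightarrow> real^'n) \<Rightarrow> (real^'n \<Rightarrow> real^'d::finite^'n) \<Rightarrow> real^'d^'d
     \<Rightarrow> (real^'n \<Rightarrow> real) \<Rightarrow> real^'n \<Rightarrow> real" where
  "linear_HJB_op f B S \<Psi> x =
     f x \<bullet> gradient \<Psi> x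
     + 1/2 * trace (hessian \<Psi> x ** (B x ** S ** transpose (B x)))"

definition feasible ::
    "(real^'n::finite) set \<Rightarrow> (real^'n \<Rightarrow> real^'n) \<Rightarrow> (real^'n \<Rightarrow> real^'d::finite^'n) \<Rightarrow> real^'d^'d
     \<Rightarrow> (real^'n \<Rightarrow> real) \<Rightarrow> (real^'n \<Rightarrow> real) \<Rightarrow> real
     \<Rightarrow> (real^'n \<Rightarrow> real) \<times> (real^'n \<Rightarrow> real) \<times> real \<Rightarrow> bool" where
  "feasible \<Omega> f B S q \<phi> lam = (\<lambda>(\<Psi>l, \<Psi>u, \<epsilon>).
     real_polynomial_function \<Psi>l \<and> real_polynomial_function \<Psi>u \<and>
     (\<forall>x\<in>\<Omega>. 1 / lam * q x * \<Psi>l x - linear_HJB_op f B S \<Psi>l x \<le> 0) \<and>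
     (\<forall>x\<in>\<Omega>. 0 \<le> 1 / lam * q x * \<Psi>u x - linear_HJB_op f B S \<Psi>u x) \<and>
     (\<forall>x\<in>\<Omega>. \<Psi>u x - \<Psi>l x \<le> \<epsilon>) \<and>
     (\<forall>x\<in>domain_boundary \<Omega>.
        0 \<le> \<Psi>l x \<and> \<Psi>l x \<le> exp (- \<phi> x / lam) \<and> exp (- \<phi> x / lam) \<le> \<Psi>u x) \<and>
     (\<forall>i. \<forall>x\<in>\<Omega>. (0 \<le> x $ i \<longrightarrow> partial_deriv i \<Psi>l x \<le> 0) \<and>
                 (x $ i \<le> 0 \<longrightarrow> 0 \<le> partial_deriv i \<Psi>l x)) \<and>
     \<Psi>l 0 = 1)"

definition solves_P ::
    "(real^'n::finite) set \<Rightarrow> (real^'n \<Rightarrow> real^'n) \<Rightarrow> (real^'n \<Rightarrow> real^'d::finite^'n) \<Rightarrow> real^'d^'d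
     \<Rightarrow> (real^'n \<Rightarrow> real) \<Rightarrow> (real^'n \<Rightarrow> real) \<Rightarrow> real
     \<Rightarrow> (real^'n \<Rightarrow> real) \<times> (real^'n \<Rightarrow> real) \<times> real \<Rightarrow> bool" where
  "solves_P \<Omega> f B S q \<phi> lam =
     is_arg_min (\<lambda>(\<Psi>l, \<Psi>u, \<epsilon>). \<epsilon>) (feasible \<Omega> f B S q \<phi> lam)"

definition class_K :: "(real \<Rightarrow> real) set" where
  "class_K = {\<mu>. \<mu> ` {0..} \<subseteq> {0..} \<and> continuous_on {0..} \<mu> \<and> mono_on {0..} \<mu> \<and>
                 \<mu> 0 = 0 \<and> (\<forall>r>0. 0 < \<mu> r)}"

text \<open>Derivatives at points of \<open>X\<close>, which need not be open, are those of the function on an open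
  neighbourhood \<open>U\<close> of \<open>X\<close>.\<close>

definition C21_on :: "(real^'n::finite) set \<Rightarrow> (real^'n \<Rightarrow> real \<Rightarrow> real) \<Rightarrow> bool" where
  "C21_on X V \<longleftrightarrow> (\<exists>U. open U \<and> X \<subseteq> U \<and>
     (\<forall>x\<in>U. \<forall>t>0.
        (\<lambda>y. V y t) differentiable (at x) \<and>
        (\<forall>i. partial_deriv i (\<lambda>y. V y t) differentiable (at x)) \<and>
        V x differentiable (at t)) \<and>
     continuous_on (U \<times> {0<..}) (\<lambda>(x, t). V x t) \<and>
     continuous_on (U \<times> {0<..}) (\<lambda>(x, t). gradient (\<lambda>y. V y t) x) \<and>
     continuous_on (U \<times> {0<..}) (\<lambda>(x, t). hessian (\<lambda>y. V y t) x) \<and>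
     continuous_on (U \<times> {0<..}) (\<lambda>(x, t). deriv (V x) t))"

definition generator ::
    "(real^'n::finite \<Rightarrow> real^'n) \<Rightarrow> (real^'n \<Rightarrow> real^'m::finite^'n)
     \<Rightarrow> (real^'n \<Rightarrow> real^'d::finite^'n) \<Rightarrow> real^'d^'d
     \<Rightarrow> (real^'n \<Rightarrow> real \<Rightarrow> real^'m) \<Rightarrow> (real^'n \<Rightarrow> real \<Rightarrow> real) \<Rightarrow> real^'n \<Rightarrow> real \<Rightarrow> real" where
  "generator f G B S u V x t =
     deriv (V x) t
     + gradient (\<lambda>y. V y t) x \<bullet> (f x + G x *v u x t)
     + 1/2 * trace (hessian (\<lambda>y. V y t) x ** (B x ** S ** transpose (B x)))"

definition SCLF ::
    "(real^'n::finite) set \<Rightarrow> (real^'n \<Rightarrow> real^'n) \<Rightarrow> (real^'n \<Rightarrow> real^'m::finite^'n)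
     \<Rightarrow> (real^'n \<Rightarrow> real^'d::finite^'n) \<Rightarrow> real^'d^'d \<Rightarrow> (real^'n \<Rightarrow> real \<Rightarrow> real) \<Rightarrow> bool" where
  "SCLF \<Omega> f G B S V \<longleftrightarrow>
     C21_on (insert 0 \<Omega>) V \<and>
     (\<forall>t>0. pos_def_on \<Omega> (\<lambda>x. V x t)) \<and>
     (\<exists>\<mu>\<in>class_K. \<forall>x\<in>insert 0 \<Omega>. \<forall>t>0. \<mu> (norm x) \<le> V x t) \<and>
     (\<exists>u. \<forall>x\<in>\<Omega> - {0}. \<forall>t>0. generator f G B S u V x t \<le> 0)"

end

theory Submission
  imports Defs
begin

text \<open>By the weak maximum principle, \<open>\<Psi>l < 1\<close> on \<open>\<Omega>\<close> away from the origin: at an interior maximum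
  the gradient vanishes and the Hessian is negative semidefinite, so that \<open>L \<Psi>l \<le> 0\<close>, whereas
  feasibility gives \<open>L \<Psi>l \<ge> q \<Psi>l / lam > 0\<close>; at the boundary \<open>\<Psi>l \<le> exp (- \<phi> / lam)\<close>. Hence
  \<open>V = - lam ln \<Psi>l\<close> is positive definite. The feedback \<open>u = - 1/2 R\<^sup>-\<^sup>1 G\<^sup>T \<nabla>V\<close> cancels the quadratic
  term that the logarithm produces in the Hessian of \<open>V\<close>, and leaves
  \<open>generator V = - (lam / \<Psi>l) L \<Psi>l \<le> - q \<le> 0\<close>.\<close>

section \<open>Partial derivatives\<close>

lemma partial_deriv_has_derivative:
  fixes F :: "real^'n::finite \<Rightarrow> real"
  assumes "(F has_derivative F') (at x)"
  shows "partial_deriv i F x = F' (axis i 1)"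
proof -
  interpret F': bounded_linear F' using assms by (rule has_derivative_bounded_linear)
  have "((\<lambda>s. x + s *\<^sub>R axis i 1) has_derivative (\<lambda>s. s *\<^sub>R axis i 1)) (at (0::real))"
    by (auto intro!: derivative_eq_intros)
  then have "((\<lambda>s. F (x + s *\<^sub>R axis i 1)) has_derivative (\<lambda>s. F' (s *\<^sub>R axis i 1))) (at (0::real))"
    by (rule has_derivative_compose) (use assms in simp)
  then have "((\<lambda>s. F (x + s *\<^sub>R axis i 1)) has_real_derivative F' (axis i 1)) (at 0)"
    by (simp add: has_field_derivative_def F'.scaleR mult.commute[of _ "F' _"])
  then show ?thesis
    unfolding partial_deriv_def by (rule DERIV_imp_deriv)
qed

text \<open>A linear functional is determined by its values on the coordinate vectors, and there the
  total derivative agrees with the partial ones.\<close>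

lemma has_derivative_gradient:
  fixes F :: "real^'n::finite \<Rightarrow> real"
  assumes "F differentiable (at x)"
  shows "(F has_derivative (\<lambda>v. v \<bullet> gradient F x)) (at x)"
proof -
  obtain F' where F': "(F has_derivative F') (at x)"
    using assms by (auto simp: differentiable_def)
  interpret F': bounded_linear F' using F' by (rule has_derivative_bounded_linear)
  have "F' v = v \<bullet> gradient F x" for v
  proof -
    have "F' v = F' (\<Sum>i\<in>UNIV. (v $ i) *\<^sub>R axis i 1)"
      by (metis (no_types, lifting) basis_expansion scalar_mult_eq_scaleR sum.cong)
    also have "\<dots> = (\<Sum>i\<in>UNIV. v $ i * F' (axis i 1))"
      by (simp add: F'.sum F'.scaleR)
    also have "\<dots> = v \<bullet> gradient F x"
      by (simp add: gradient_def inner_vec_def partial_deriv_has_derivative[OF F'])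
    finally show ?thesis .
  qed
  then have "F' = (\<lambda>v. v \<bullet> gradient F x)" by auto
  with F' show ?thesis by simp
qed

lemma has_real_derivative_along_line:
  fixes F :: "real^'n::finite \<Rightarrow> real"
  assumes "F differentiable (at (x + s *\<^sub>R v))"
  shows "((\<lambda>s. F (x + s *\<^sub>R v)) has_real_derivative v \<bullet> gradient F (x + s *\<^sub>R v)) (at s)"
proof -
  have "((\<lambda>s. x + s *\<^sub>R v) has_derivative (\<lambda>s. s *\<^sub>R v)) (at s)"
    by (auto intro!: derivative_eq_intros)
  from has_derivative_compose[OF this has_derivative_gradient[OF assms]]
  show ?thesis
    by (simp add: has_field_derivative_def mult.commute[of _ "v \<bullet> _"])
qed

text \<open>Serves the second derivatives of \<open>- lam * ln (p y)\<close>: the formula for the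
  first ones is established only where \<open>p\<close> is positive, that is, on a neighbourhood of
  the point.\<close>

lemma partial_deriv_cong_ev:
  fixes F H :: "real^'n::finite \<Rightarrow> real"
  assumes "open U" "x \<in> U" "\<And>y. y \<in> U \<Longrightarrow> F y = H y"
  shows "partial_deriv i F x = partial_deriv i H x"
proof -
  have "((\<lambda>s. x + s *\<^sub>R axis i 1) \<longlongrightarrow> x + 0 *\<^sub>R axis i 1) (nhds (0::real))"
    by (intro tendsto_intros filterlim_ident)
  then have "\<forall>\<^sub>F s in nhds (0::real). x + s *\<^sub>R axis i 1 \<in> U"
    using assms(1,2) by (auto simp: tendsto_def)
  then have "\<forall>\<^sub>F s in nhds (0::real). F (x + s *\<^sub>R axis i 1) = H (x + s *\<^sub>R axis i 1)"
    by eventually_elim (use assms(3) in auto)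
  then show ?thesis
    unfolding partial_deriv_def by (rule deriv_cong_ev) simp
qed

lemma differentiable_real_polynomial_function:
  fixes p :: "real^'n::finite \<Rightarrow> real"
  assumes "real_polynomial_function p"
  shows "p differentiable (at x)"
  using assms by (simp add: differentiable_at_polynomial_function real_polynomial_function_eq)

text \<open>The sum and product rules carry the claim through the inductive generation of
  polynomials. Differentiability and continuity of the derivatives of every order then follow at
  once.\<close>

lemma real_polynomial_function_partial_deriv:
  fixes p :: "real^'n::finite \<Rightarrow> real"
  assumes "real_polynomial_function p"
  shows "real_polynomial_function (partial_deriv i p)"
  using assms
proof induction
  case (linear p)
  have "partial_deriv i p = (\<lambda>x. p (axis i 1))"
    by (rule ext, rule partial_deriv_has_derivative, rule bounded_linear_imp_has_derivative, fact)
  then show ?case by (simp add: real_polynomial_function.intros)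
next
  case (const c)
  have "partial_deriv i (\<lambda>x. c) = (\<lambda>x. 0)"
    by (simp add: partial_deriv_def fun_eq_iff)
  then show ?case by (simp add: real_polynomial_function.intros)
next
  case (add p r)
  have "partial_deriv i (\<lambda>x. p x + r x) = (\<lambda>x. partial_deriv i p x + partial_deriv i r x)"
  proof
    fix x
    note d = has_derivative_gradient[OF differentiable_real_polynomial_function[of _ x]]
    show "partial_deriv i (\<lambda>x. p x + r x) x = partial_deriv i p x + partial_deriv i r x"
      by (subst partial_deriv_has_derivative[OF has_derivative_add[OF d d]])
         (use add in \<open>auto simp: gradient_def inner_axis'\<close>)
  qed
  then show ?case using add by (simp add: real_polynomial_function.intros)
next
  case (mult p r)
  have "partial_deriv i (\<lambda>x. p x * r x) = (\<lambda>x. p x * partial_deriv i r x + partial_deriv i p x * r x)"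
  proof
    fix x
    note d = has_derivative_gradient[OF differentiable_real_polynomial_function[of _ x]]
    show "partial_deriv i (\<lambda>x. p x * r x) x = p x * partial_deriv i r x + partial_deriv i p x * r x"
      by (subst partial_deriv_has_derivative[OF has_derivative_mult[OF d d]])
         (use mult in \<open>auto simp: gradient_def inner_axis'\<close>)
  qed
  then show ?case using mult
    by (simp add: real_polynomial_function.intros)
qed

lemma continuous_on_real_polynomial_function:
  fixes p :: "real^'n::finite \<Rightarrow> real"
  assumes "real_polynomial_function p"
  shows "continuous_on A p"
  using assms by (simp add: continuous_on_polymonial_function real_polynomial_function_eq)

section \<open>Positive semidefinite matrices\<close>

lemma quadratic_form_sum:
  fixes A :: "real^'n^'n::finite"
  shows "v \<bullet> (A *v v) = (\<Sum>i\<in>UNIV. \<Sum>j\<in>UNIV. v $ i * A $ i $ j * v $ j)"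
  by (simp add: inner_vec_def matrix_vector_mult_def sum_distrib_left mult.assoc)

lemma trace_mult_sum:
  fixes A C :: "real^'n^'n::finite"
  shows "trace (A ** C) = (\<Sum>i\<in>UNIV. \<Sum>j\<in>UNIV. A $ i $ j * C $ j $ i)"
  by (simp add: trace_def matrix_matrix_mult_def)

lemma pos_semidef_matrix_congruence:
  fixes S :: "real^'d^'d::finite" and B :: "real^'d^'n::finite"
  assumes "pos_semidef_matrix S"
  shows "pos_semidef_matrix (B ** S ** transpose B)"
proof -
  have "v \<bullet> ((B ** S ** transpose B) *v v) = (transpose B *v v) \<bullet> (S *v (transpose B *v v))" for v
    by (metis dot_lmul_matrix matrix_vector_mul_assoc transpose_matrix_vector)
  then show ?thesis
    using assms by (simp add: pos_semidef_matrix_def matrix_transpose_mul matrix_mul_assoc)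
qed

text \<open>The form takes the value \<open>-1\<close> at \<open>s e\<^sub>i + e\<^sub>j\<close> for a suitable \<open>s\<close> unless \<open>C\<^sub>i\<^sub>j = 0\<close>.\<close>

lemma pos_semidef_matrix_zero_diagonal:
  fixes C :: "real^'n^'n::finite"
  assumes "pos_semidef_matrix C" "C $ i $ i = 0"
  shows "C $ i $ j = 0"
proof (rule ccontr)
  assume nz: "C $ i $ j \<noteq> 0"
  have sym: "C $ j $ i = C $ i $ j"
    using assms(1) unfolding pos_semidef_matrix_def by (metis transpose_def vec_lambda_beta)
  define s where "s = - (C $ j $ j + 1) / (2 * C $ i $ j)"
  have e: "axis a (1::real) \<bullet> (C *v axis b 1) = C $ a $ b" for a b
    by (simp add: inner_axis' matrix_vector_mul_component inner_axis)
  have "0 \<le> (s *\<^sub>R axis i 1 + axis j 1) \<bullet> (C *v (s *\<^sub>R axis i 1 + axis j 1))"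
    using assms(1) unfolding pos_semidef_matrix_def by blast
  also have "\<dots> = s * s * C $ i $ i + s * C $ i $ j + s * C $ j $ i + C $ j $ j"
    by (simp add: matrix_vector_right_distrib matrix_vector_mult_scaleR inner_add_left
        inner_add_right e algebra_simps)
  also have "\<dots> = 2 * s * C $ i $ j + C $ j $ j"
    using assms(2) sym by simp
  also have "\<dots> = -1"
    using nz by (simp add: s_def field_simps)
  finally show False by simp
qed

text \<open>Symmetric Gaussian elimination peels off rank-one terms \<open>c c\<^sup>T / C\<^sub>i\<^sub>i\<close>, where \<open>c\<close> is the
  \<open>i\<close>th row of \<open>C\<close>; the induction is on the number of nonzero rows.\<close>

lemma trace_mult_pos_semidef_nonpos:
  fixes A C :: "real^'n^'n::finite"
  assumes A: "\<And>v. v \<bullet> (A *v v) \<le> 0" and C: "pos_semidef_matrix C"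
  shows "trace (A ** C) \<le> 0"
  using C
proof (induction "card {i. C $ i \<noteq> 0}" arbitrary: C rule: less_induct)
  case less
  show ?case
  proof (cases "\<forall>i. C $ i = 0")
    case True
    then show ?thesis by (simp add: trace_mult_sum)
  next
    case False
    then obtain i where "C $ i \<noteq> 0" by blast
    then obtain j where "C $ i $ j \<noteq> 0" by (auto simp: vec_eq_iff)
    with pos_semidef_matrix_zero_diagonal[OF less.prems] have nz: "C $ i $ i \<noteq> 0" by blast
    have sym: "C $ a $ b = C $ b $ a" for a b
      using less.prems unfolding pos_semidef_matrix_def by (metis transpose_def vec_lambda_beta)
    have psd: "0 \<le> v \<bullet> (C *v v)" for v
      using less.prems by (simp add: pos_semidef_matrix_def)
    have "axis i (1::real) \<bullet> (C *v axis i 1) = C $ i $ i"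
      by (simp add: inner_axis' matrix_vector_mul_component inner_axis)
    with psd[of "axis i 1"] nz have pos: "0 < C $ i $ i" by simp
    define D where "D = (\<chi> a b. C $ a $ b - C $ i $ a * C $ i $ b / C $ i $ i)"
    have quadD: "v \<bullet> (D *v v) = v \<bullet> (C *v v) - (C $ i \<bullet> v)\<^sup>2 / C $ i $ i" for v
    proof -
      have "(C $ i \<bullet> v)\<^sup>2 = (\<Sum>a\<in>UNIV. \<Sum>b\<in>UNIV. v $ a * (C $ i $ a * C $ i $ b) * v $ b)"
        by (simp add: power2_eq_square inner_vec_def sum_product mult_ac)
      then show ?thesis
        by (simp add: quadratic_form_sum D_def algebra_simps sum_subtractf sum_divide_distrib
            diff_divide_distrib)
    qed
    have "0 \<le> v \<bullet> (D *v v)" for v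
    proof -
      \<comment> \<open>This \<open>s\<close> minimizes the form of \<open>C\<close> on the line
        through \<open>v\<close> in the direction of the \<open>i\<close>th axis. Completing the
        square shows that the minimum is the value of the form of \<open>D\<close> at
        \<open>v\<close>.\<close>
      define s where "s = (C $ i \<bullet> v) / C $ i $ i"
      let ?w = "v - s *\<^sub>R axis i 1"
      have e1: "axis i 1 \<bullet> (C *v v) = C $ i \<bullet> v"
        by (simp add: inner_axis' matrix_vector_mul_component)
      have e2: "v \<bullet> (C *v axis i 1) = C $ i \<bullet> v"
        using e1 less.prems unfolding pos_semidef_matrix_def
        by (metis dot_lmul_matrix inner_commute transpose_matrix_vector)
      have "?w \<bullet> (C *v ?w) = v \<bullet> (C *v v) - 2 * s * (C $ i \<bullet> v) + s * s * C $ i $ i"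
        using \<open>axis i (1::real) \<bullet> (C *v axis i 1) = C $ i $ i\<close>
        by (simp add: matrix_vector_mult_diff_distrib matrix_vector_mult_scaleR inner_diff_left
            inner_diff_right e1 e2 algebra_simps)
      also have "\<dots> = v \<bullet> (D *v v)"
        using pos by (simp add: quadD s_def power2_eq_square field_simps)
      finally show ?thesis using psd[of ?w] by simp
    qed
    moreover have "transpose D = D"
      by (simp add: transpose_def D_def vec_eq_iff sym[of _ _] mult.commute)
    ultimately have D: "pos_semidef_matrix D" by (simp add: pos_semidef_matrix_def)
    \<comment> \<open>Elimination clears row \<open>i\<close>. A vanishing row \<open>a\<close> of
      \<open>C\<close> stays zero in \<open>D\<close>, because by symmetry the factor
      \<open>C $ i $ a\<close> vanishes too.\<close>
    have "{a. D $ a \<noteq> 0} \<subset> {a. C $ a \<noteq> 0}"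
    proof
      show "{a. D $ a \<noteq> 0} \<subseteq> {a. C $ a \<noteq> 0}"
      proof
        fix a assume "a \<in> {a. D $ a \<noteq> 0}"
        then obtain b where b: "D $ a $ b \<noteq> 0" by (auto simp: vec_eq_iff)
        have "D $ a $ b = 0" if "C $ a = 0"
          using that sym[of i a] by (simp add: D_def)
        with b show "a \<in> {a. C $ a \<noteq> 0}" by blast
      qed
      have "D $ i = 0" using nz by (simp add: D_def vec_eq_iff)
      with \<open>C $ i \<noteq> 0\<close> show "{a. D $ a \<noteq> 0} \<noteq> {a. C $ a \<noteq> 0}" by blast
    qed
    then have "card {a. D $ a \<noteq> 0} < card {a. C $ a \<noteq> 0}"
      by (intro psubset_card_mono) auto
    from less.hyps[OF this D] have "trace (A ** D) \<le> 0" .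
    \<comment> \<open>The rank-one term contributes the form of \<open>A\<close> at the row
      \<open>C $ i\<close>, divided by the positive pivot; this is where the sign of the form of
      \<open>A\<close> enters.\<close>
    moreover have "trace (A ** C) = trace (A ** D) + C $ i \<bullet> (A *v (C $ i)) / C $ i $ i"
      by (simp add: trace_mult_sum quadratic_form_sum D_def sum_divide_distrib
          flip: sum.distrib) (simp add: field_simps nz)
    moreover have "C $ i \<bullet> (A *v (C $ i)) / C $ i $ i \<le> 0"
      using A[of "C $ i"] pos by (simp add: divide_nonpos_pos)
    ultimately show ?thesis by simp
  qed
qed

section \<open>The maximum principle\<close>

text \<open>If \<open>c\<close> were positive, \<open>F'\<close> would be positive just to the right
  of its zero \<open>a\<close>, and the mean value theorem would push \<open>F\<close> above its
  local maximum.\<close>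

lemma deriv_second_nonpos_at_local_max:
  fixes F F' :: "real \<Rightarrow> real"
  assumes F: "\<And>s. (F has_real_derivative F' s) (at s)"
    and F': "(F' has_real_derivative c) (at a)"
    and "0 < d" and max: "\<And>s. \<bar>a - s\<bar> < d \<Longrightarrow> F s \<le> F a"
  shows "F' a = 0" "c \<le> 0"
proof -
  show F'a: "F' a = 0"
    using DERIV_local_max[OF F \<open>0 < d\<close>] max by blast
  show "c \<le> 0"
  proof (rule ccontr)
    assume "\<not> c \<le> 0"
    then obtain e where e: "e > 0" "\<And>h. 0 < h \<Longrightarrow> h < e \<Longrightarrow> F' a < F' (a + h)"
      using DERIV_pos_inc_right[OF F'] by auto
    \<comment> \<open>Below both radii: \<open>d\<close> keeps \<open>a + h\<close> in the range of
      the maximum, and \<open>e\<close> makes \<open>F'\<close> positive at the intermediate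
      point.\<close>
    define h where "h = min d e / 2"
    have h: "0 < h" "h < d" "h < e" using e(1) \<open>0 < d\<close> by (auto simp: h_def)
    obtain z where z: "a < z" "z < a + h" "F (a + h) - F a = (a + h - a) * F' z"
      using MVT2[of a "a + h" F F'] F h(1) by auto
    have "0 < F' z" using e(2)[of "z - a"] z h F'a by auto
    then have "F a < F (a + h)" using z h
      by (metis add_diff_cancel_left' diff_gt_0_iff_gt zero_less_mult_iff)
    moreover have "F (a + h) \<le> F a" using h by (intro max) auto
    ultimately show False by simp
  qed
qed

text \<open>Restriction to the lines through \<open>y\<close> reduces both claims to the second
  derivative test in one variable.\<close>

lemma gradient_hessian_at_interior_max:
  fixes p :: "real^'n::finite \<Rightarrow> real"
  assumes p: "real_polynomial_function p"
    and y: "y \<in> interior X" and max: "\<And>x. x \<in> X \<Longrightarrow> p x \<le> p y"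
  shows "gradient p y = 0" "v \<bullet> (hessian p y *v v) \<le> 0"
proof -
  have dir: "v \<bullet> gradient p y = 0 \<and> v \<bullet> (hessian p y *v v) \<le> 0" for v
  proof -
    have F: "((\<lambda>s. p (y + s *\<^sub>R v)) has_real_derivative v \<bullet> gradient p (y + s *\<^sub>R v)) (at s)" for s
      by (intro has_real_derivative_along_line differentiable_real_polynomial_function p)
    have "((\<lambda>s. \<Sum>j\<in>UNIV. v $ j * partial_deriv j p (y + s *\<^sub>R v)) has_real_derivative
        (\<Sum>j\<in>UNIV. v $ j * (v \<bullet> gradient (partial_deriv j p) (y + 0 *\<^sub>R v)))) (at 0)"
      by (intro DERIV_sum DERIV_cmult has_real_derivative_along_line
          differentiable_real_polynomial_function real_polynomial_function_partial_deriv p)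
    \<comment> \<open>Entry \<open>i j\<close> of \<open>hessian\<close> differentiates by
      \<open>j\<close> first, as the left side does, so an exchange of the two sums
      suffices.\<close>
    moreover have "(\<Sum>j\<in>UNIV. v $ j * (v \<bullet> gradient (partial_deriv j p) (y + 0 *\<^sub>R v)))
        = v \<bullet> (hessian p y *v v)"
      unfolding quadratic_form_sum
      by (subst sum.swap) (simp add: hessian_def inner_vec_def gradient_def sum_distrib_left mult_ac)
    ultimately have F': "((\<lambda>s. v \<bullet> gradient p (y + s *\<^sub>R v)) has_real_derivative
        v \<bullet> (hessian p y *v v)) (at 0)"
      by (simp add: inner_vec_def gradient_def)
    have "((\<lambda>s. y + s *\<^sub>R v) \<longlongrightarrow> y + 0 *\<^sub>R v) (nhds (0::real))"
      by (intro tendsto_intros filterlim_ident)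
    then have "\<forall>\<^sub>F s in nhds (0::real). y + s *\<^sub>R v \<in> interior X"
      using y by (auto simp: tendsto_def)
    then obtain d where d: "d > 0" "\<And>s. \<bar>s\<bar> < d \<Longrightarrow> y + s *\<^sub>R v \<in> interior X"
      by (auto simp: eventually_nhds_metric dist_real_def)
    have "p (y + s *\<^sub>R v) \<le> p (y + 0 *\<^sub>R v)" if "\<bar>0 - s\<bar> < d" for s
      using max d(2)[of s] that interior_subset[of X] by auto
    from deriv_second_nonpos_at_local_max[OF F F' d(1) this] show ?thesis by simp
  qed
  show "v \<bullet> (hessian p y *v v) \<le> 0" using dir by blast
  \<comment> \<open>The derivative in the direction of the gradient is the squared norm of the
    gradient.\<close>
  show "gradient p y = 0" using dir[of "gradient p y"] by simp
qed

lemma linear_HJB_op_nonpos_at_interior_max: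
  fixes p :: "real^'n::finite \<Rightarrow> real"
  assumes p: "real_polynomial_function p" and S: "pos_semidef_matrix S"
    and y: "y \<in> interior X" "\<And>x. x \<in> X \<Longrightarrow> p x \<le> p y"
  shows "linear_HJB_op f B S p y \<le> 0"
  using gradient_hessian_at_interior_max[OF p y] pos_semidef_matrix_congruence[OF S, of "B y"]
  by (simp add: linear_HJB_op_def trace_mult_pos_semidef_nonpos)

section \<open>Lower bounds by comparison functions\<close>

text \<open>The comparison function is the Lipschitz regularization \<open>\<mu> r = min (V x + max 0 (r - |x|))\<close> over
  \<open>x \<in> X\<close>.\<close>

lemma class_K_lower_bound:
  fixes V :: "real^'n::finite \<Rightarrow> real"
  assumes X: "compact X" "0 \<in> X" and V: "continuous_on X V" "pos_def_on X V"
  shows "\<exists>\<mu>\<in>class_K. \<forall>x\<in>X. \<mu> (norm x) \<le> V x"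
proof -
  define \<rho> where "\<rho> r x = V x + max 0 (r - norm x)" for r x
  define \<mu> where "\<mu> r = (INF x\<in>X. \<rho> r x)" for r
  have nonneg: "0 \<le> \<rho> r x" if "x \<in> X" for r x
    using V(2) that by (cases "x = 0") (auto simp: \<rho>_def pos_def_on_def less_imp_le)
  have bdd: "bdd_below (\<rho> r ` X)" for r
    using nonneg by (intro bdd_belowI[of _ 0]) auto
  have le: "\<mu> r \<le> \<rho> r x" if "x \<in> X" for r x
    unfolding \<mu>_def by (rule cINF_lower[OF bdd that])
  \<comment> \<open>Compactness turns the infimum into a minimum; the strict positivity of
    \<open>\<mu>\<close> below relies on this.\<close>
  have attained: "\<exists>x\<in>X. \<mu> r = \<rho> r x" for r
  proof -
    have "continuous_on X (\<rho> r)"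
      unfolding \<rho>_def by (intro continuous_intros V(1))
    then obtain x where x: "x \<in> X" "\<And>y. y \<in> X \<Longrightarrow> \<rho> r x \<le> \<rho> r y"
      using continuous_attains_inf[OF X(1)] X(2) by blast
    have "\<rho> r x \<le> \<mu> r"
      unfolding \<mu>_def using x X(2) by (intro cINF_greatest) auto
    with le[OF x(1), of r] x(1) show ?thesis by (intro bexI[of _ x]) auto
  qed
  \<comment> \<open>For fixed \<open>x\<close> the value \<open>\<rho> r x\<close> is 1-Lipschitz in
    \<open>r\<close>, and a minimum of such functions inherits the constant.\<close>
  have lip: "\<mu> r \<le> \<mu> s + \<bar>r - s\<bar>" for r s
  proof -
    obtain x where x: "x \<in> X" "\<mu> s = \<rho> s x" using attained by blast
    have "\<rho> r x \<le> \<rho> s x + \<bar>r - s\<bar>" by (auto simp: \<rho>_def)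
    with le[OF x(1), of r] x(2) show ?thesis by linarith
  qed
  have mu0: "\<mu> 0 = 0"
  proof -
    have "\<rho> 0 0 = 0" using V(2) by (simp add: \<rho>_def pos_def_on_def)
    then show ?thesis using le[OF X(2), of 0] attained[of 0] nonneg by (metis order_antisym)
  qed
  have "\<mu> \<in> class_K"
    unfolding class_K_def
  proof (intro CollectI conjI allI impI)
    show "\<mu> ` {0..} \<subseteq> {0..}"
      using attained nonneg by (metis (no_types, lifting) atLeast_iff image_subsetI)
    have "1-lipschitz_on {0..} \<mu>"
    proof (rule lipschitz_onI)
      show "dist (\<mu> r) (\<mu> s) \<le> 1 * dist r s" for r s
        using lip[of r s] lip[of s r] by (simp add: dist_real_def)
    qed simp
    then show "continuous_on {0..} \<mu>" by (rule lipschitz_on_continuous_on)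
    show "mono_on {0..} \<mu>"
    proof (rule mono_onI)
      fix r s :: real assume "r \<le> s"
      obtain x where x: "x \<in> X" "\<mu> s = \<rho> s x" using attained by blast
      have "\<rho> r x \<le> \<rho> s x" using \<open>r \<le> s\<close> by (auto simp: \<rho>_def)
      with le[OF x(1), of r] x(2) show "\<mu> r \<le> \<mu> s" by linarith
    qed
    show "\<mu> 0 = 0" by (fact mu0)
    fix r :: real assume "0 < r"
    obtain x where x: "x \<in> X" "\<mu> r = \<rho> r x" using attained by blast
    \<comment> \<open>At the minimizer \<open>x = 0\<close> the penalty alone equals
      \<open>r\<close>; at any other minimizer \<open>V x\<close> is already positive.\<close>
    show "0 < \<mu> r"
      using V(2) x \<open>0 < r\<close> by (cases "x = 0") (auto simp: \<rho>_def pos_def_on_def add_pos_nonneg)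
  qed
  \<comment> \<open>At radius \<open>norm x\<close> the competitor \<open>x\<close> itself carries
    no penalty.\<close>
  moreover have "\<mu> (norm x) \<le> V x" if "x \<in> X" for x
    using le[OF that, of "norm x"] by (simp add: \<rho>_def)
  ultimately show ?thesis by blast
qed

section \<open>The logarithmic transformation\<close>

lemma
  fixes p :: "real^'n::finite \<Rightarrow> real"
  assumes p: "real_polynomial_function p" and x: "0 < p x"
  shows has_derivative_log_transform:
      "((\<lambda>y. - lam * ln (p y)) has_derivative (\<lambda>v. - lam / p x * (v \<bullet> gradient p x))) (at x)"
    and partial_deriv_log_transform:
      "partial_deriv i (\<lambda>y. - lam * ln (p y)) x = - lam / p x * partial_deriv i p x"
proof -
  note d = has_derivative_gradient[OF differentiable_real_polynomial_function[OF p]]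
  show *: "((\<lambda>y. - lam * ln (p y)) has_derivative (\<lambda>v. - lam / p x * (v \<bullet> gradient p x))) (at x)"
    using x by (auto intro!: derivative_eq_intros d simp: fun_eq_iff field_simps)
  show "partial_deriv i (\<lambda>y. - lam * ln (p y)) x = - lam / p x * partial_deriv i p x"
    unfolding partial_deriv_has_derivative[OF *] by (simp add: inner_axis' gradient_def)
qed

lemma gradient_log_transform:
  fixes p :: "real^'n::finite \<Rightarrow> real"
  assumes "real_polynomial_function p" "0 < p x"
  shows "gradient (\<lambda>y. - lam * ln (p y)) x = (- lam / p x) *\<^sub>R gradient p x"
  using partial_deriv_log_transform[OF assms] by (simp add: gradient_def vec_eq_iff)

text \<open>Differentiating the factor \<open>1 / p\<close> produces a rank-one term in the gradient
  of \<open>p\<close>. This is the quadratic term that the feedback has to cancel.\<close>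

lemma
  fixes p :: "real^'n::finite \<Rightarrow> real"
  assumes p: "real_polynomial_function p" and x: "0 < p x"
  shows differentiable_partial_deriv_log_transform:
      "partial_deriv j (\<lambda>y. - lam * ln (p y)) differentiable (at x)"
    and partial_deriv2_log_transform:
      "partial_deriv i (partial_deriv j (\<lambda>y. - lam * ln (p y))) x
        = - lam / p x * partial_deriv i (partial_deriv j p) x
          + lam / (p x)\<^sup>2 * (partial_deriv i p x * partial_deriv j p x)"
proof -
  define U where "U = {y. 0 < p y}"
  have U: "open U" "x \<in> U"
    using x continuous_on_real_polynomial_function[OF p]
    by (auto simp: U_def intro: open_Collect_less continuous_on_const)
  have eq: "partial_deriv j (\<lambda>y. - lam * ln (p y)) y = - lam / p y * partial_deriv j p y"
    if "y \<in> U" for y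
    using that partial_deriv_log_transform[OF p] by (simp add: U_def)
  note d = has_derivative_gradient[OF differentiable_real_polynomial_function]
  have *: "((\<lambda>y. - lam / p y * partial_deriv j p y) has_derivative
     (\<lambda>v. - lam / p x * (v \<bullet> gradient (partial_deriv j p) x)
       + lam / (p x)\<^sup>2 * ((v \<bullet> gradient p x) * partial_deriv j p x))) (at x)"
    using x by (auto intro!: derivative_eq_intros d[OF p]
        d[OF real_polynomial_function_partial_deriv[OF p]]
        simp: fun_eq_iff field_simps power2_eq_square)
  have "(partial_deriv j (\<lambda>y. - lam * ln (p y)) has_derivative
     (\<lambda>v. - lam / p x * (v \<bullet> gradient (partial_deriv j p) x)
       + lam / (p x)\<^sup>2 * ((v \<bullet> gradient p x) * partial_deriv j p x))) (at x)"
    by (rule has_derivative_transform_within_open[OF * U]) (rule eq[symmetric])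
  then show "partial_deriv j (\<lambda>y. - lam * ln (p y)) differentiable (at x)"
    by (auto simp: differentiable_def)
  show "partial_deriv i (partial_deriv j (\<lambda>y. - lam * ln (p y))) x
        = - lam / p x * partial_deriv i (partial_deriv j p) x
          + lam / (p x)\<^sup>2 * (partial_deriv i p x * partial_deriv j p x)"
    using partial_deriv_cong_ev[where i=i, OF U eq] partial_deriv_has_derivative[OF *, where i=i]
    by (simp add: inner_axis' gradient_def del: mult_minus_left minus_divide_left)
qed

lemma hessian_log_transform:
  fixes p :: "real^'n::finite \<Rightarrow> real"
  assumes "real_polynomial_function p" "0 < p x"
  shows "hessian (\<lambda>y. - lam * ln (p y)) x
    = (\<chi> i j. - lam / p x * hessian p x $ i $ j
               + lam / (p x)\<^sup>2 * (gradient p x $ i * gradient p x $ j))"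
  using partial_deriv2_log_transform[OF assms] by (simp add: hessian_def gradient_def vec_eq_iff)

text \<open>The neighbourhood required by \<open>C21_on\<close> is the positivity set of
  \<open>p\<close>. There the gradient and the Hessian are rational expressions whose denominators
  are powers of \<open>p\<close>.\<close>

lemma C21_on_log_transform:
  fixes p :: "real^'n::finite \<Rightarrow> real"
  assumes p: "real_polynomial_function p" and pos: "\<forall>x\<in>X. 0 < p x"
  shows "C21_on X (\<lambda>x t. - lam * ln (p x))"
  unfolding C21_on_def
proof (intro exI conjI ballI allI impI)
  let ?U = "{x. 0 < p x}"
  let ?V = "\<lambda>x. - lam * ln (p x)"
  have cont: "continuous_on (?U \<times> {0<..}) (\<lambda>z. r (fst z))"
    if "real_polynomial_function r" for r :: "real^'n \<Rightarrow> real"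
    by (rule continuous_on_compose2[OF continuous_on_real_polynomial_function[OF that, of UNIV]])
       (auto intro: continuous_intros)
  note pp = real_polynomial_function_partial_deriv
  show "open ?U"
    using continuous_on_real_polynomial_function[OF p]
    by (auto intro: open_Collect_less continuous_on_const)
  show "X \<subseteq> ?U" using pos by auto
  show "?V differentiable (at x)" if "x \<in> ?U" for x
    using has_derivative_log_transform[OF p, of x] that by (auto simp: differentiable_def)
  show "partial_deriv i ?V differentiable (at x)" if "x \<in> ?U" for x i
    using differentiable_partial_deriv_log_transform[OF p] that by auto
  show "(\<lambda>t::real. ?V x) differentiable (at t)" for x t by simp
  show "continuous_on (?U \<times> {0<..}) (\<lambda>(x, t::real). ?V x)"
    unfolding case_prod_beta by (intro continuous_intros cont p) auto
  have "continuous_on (?U \<times> {0<..}) (\<lambda>z::(real^'n) \<times> real.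
      (- lam / p (fst z)) *\<^sub>R (\<chi> i. partial_deriv i p (fst z)))"
    by (intro continuous_intros cont p pp) auto
  then show "continuous_on (?U \<times> {0<..}) (\<lambda>(x, t::real). gradient ?V x)"
    by (rule continuous_on_eq) (use gradient_log_transform[OF p] in \<open>auto simp: gradient_def\<close>)
  have "continuous_on (?U \<times> {0<..}) (\<lambda>z::(real^'n) \<times> real.
      \<chi> i j. - lam / p (fst z) * partial_deriv i (partial_deriv j p) (fst z)
        + lam / (p (fst z))\<^sup>2 * (partial_deriv i p (fst z) * partial_deriv j p (fst z)))"
    by (intro continuous_intros cont p pp) auto
  then show "continuous_on (?U \<times> {0<..}) (\<lambda>(x, t::real). hessian ?V x)"
    by (rule continuous_on_eq)
       (use hessian_log_transform[OF p] in \<open>auto simp: hessian_def gradient_def\<close>)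
  show "continuous_on (?U \<times> {0<..}) (\<lambda>(x, t::real). deriv (\<lambda>t. ?V x) t)"
    by simp
qed

text \<open>In the application \<open>K\<close> is the inverse of \<open>R\<close>. The control
  contributes \<open>- lam^2 / (2 p^2)\<close> times the form of \<open>G K G^T\<close> at the
  gradient of \<open>p\<close>; by \<open>cov\<close>, half the trace of the rank-one part of the
  Hessian against the diffusion matrix contributes the opposite amount.\<close>

lemma generator_log_transform:
  fixes p :: "real^'n::finite \<Rightarrow> real" and G :: "real^'n \<Rightarrow> real^'m::finite^'n"
    and B :: "real^'n \<Rightarrow> real^'d::finite^'n"
  assumes p: "real_polynomial_function p" and x: "0 < p x" and lam: "0 < lam"
    and cov: "lam *\<^sub>R (G x ** K ** transpose (G x)) = B x ** S ** transpose (B x)"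
  shows "generator f G B S
      (\<lambda>x t. (lam / (2 * p x)) *\<^sub>R (K *v (transpose (G x) *v gradient p x)))
      (\<lambda>x t. - lam * ln (p x)) x t
    = - lam / p x * linear_HJB_op f B S p x"
proof -
  let ?C = "B x ** S ** transpose (B x)"
  let ?g = "gradient p x"
  \<comment> \<open>The trace of the rank-one matrix \<open>v v^T\<close> against \<open>C\<close>
    is the form of \<open>C\<close> at \<open>v\<close>.\<close>
  have "trace ((\<chi> i j. a * H $ i $ j + c * (v $ i * v $ j)) ** C)
      = a * trace (H ** C) + c * (v \<bullet> (C *v v))" for a c v and H C :: "real^'n^'n"
  proof -
    have "v \<bullet> (C *v v) = (\<Sum>i\<in>UNIV. \<Sum>j\<in>UNIV. v $ i * v $ j * C $ j $ i)"
      unfolding quadratic_form_sum by (subst sum.swap) (simp add: mult_ac)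
    then show ?thesis
      by (simp add: trace_mult_sum sum_distrib_left distrib_right sum.distrib mult.assoc)
  qed
  then have tr: "trace (hessian (\<lambda>y. - lam * ln (p y)) x ** ?C)
      = - lam / p x * trace (hessian p x ** ?C) + lam / (p x)\<^sup>2 * (?g \<bullet> (?C *v ?g))"
    unfolding hessian_log_transform[where p=p, OF p x] .
  \<comment> \<open>Expresses the control term through the diffusion matrix, so that it can be
    compared with the last term of \<open>tr\<close>.\<close>
  have "lam *\<^sub>R (G x *v (K *v (transpose (G x) *v ?g))) = ?C *v ?g"
    by (simp add: matrix_vector_mul_assoc scaleR_matrix_vector_assoc matrix_mul_assoc
        del: transpose_matrix_vector flip: cov)
  then have gu: "lam * (?g \<bullet> (G x *v (K *v (transpose (G x) *v ?g)))) = ?g \<bullet> (?C *v ?g)"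
    by (metis inner_scaleR_right)
  have "generator f G B S
      (\<lambda>x t. (lam / (2 * p x)) *\<^sub>R (K *v (transpose (G x) *v gradient p x)))
      (\<lambda>x t. - lam * ln (p x)) x t
    = - lam / p x * (?g \<bullet> f x + lam / (2 * p x) * (?g \<bullet> (G x *v (K *v (transpose (G x) *v ?g)))))
      + 1/2 * trace (hessian (\<lambda>y. - lam * ln (p y)) x ** ?C)"
    by (simp only: generator_def gradient_log_transform[where p=p, OF p x]
        matrix_vector_mult_scaleR inner_add_right inner_scaleR_left inner_scaleR_right
        deriv_const add_0_left distrib_left mult.left_commute)
  also have "\<dots> = - lam / p x * (f x \<bullet> ?g + 1/2 * trace (hessian p x ** ?C))"
    unfolding tr using x
    by (simp add: inner_commute[of "f x"] field_simps power2_eq_square flip: gu)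
  finally show ?thesis by (simp add: linear_HJB_op_def)
qed

section \<open>Verification of the Lyapunov conditions for a solution of (P)\<close>

lemma brownian_motion_pos_semidef:
  assumes "brownian_motion M W S"
  shows "pos_semidef_matrix S"
proof -
  \<comment> \<open>An increment over a unit interval has covariance \<open>S\<close> itself, and
    \<open>centred_gaussian\<close> includes semidefiniteness.\<close>
  have "centred_gaussian M (\<lambda>w. W 1 w - W 0 w) ((1 - 0) *\<^sub>R S)"
    using assms unfolding brownian_motion_def by (meson order_refl zero_le_one)
  then show ?thesis by (simp add: centred_gaussian_def)
qed

theorem theorem21:
  fixes \<Omega> :: "(real^'n::finite) set"
    and g h :: "nat \<Rightarrow> real^'n \<Rightarrow> real"
    and k m :: nat
    and f :: "real^'n \<Rightarrow> real^'n"
    and G :: "real^'n \<Rightarrow> real^'m::finite^'n"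
    and B :: "real^'n \<Rightarrow> real^'d::finite^'n"
    and M :: "'w measure"
    and W :: "real \<Rightarrow> 'w \<Rightarrow> real^'d"
    and S :: "real^'d^'d"
    and R :: "real^'m^'m"
    and q \<phi> \<Psi>l \<Psi>u :: "real^'n \<Rightarrow> real"
    and lam \<epsilon> :: real
  assumes compact_domain: "compact \<Omega>"
    and zero_in_domain: "0 \<in> \<Omega>"
    and g_poly: "\<forall>i\<in>{1..k}. real_polynomial_function (g i)"
    and domain_eq: "\<Omega> = {x. \<forall>i\<in>{1..k}. 0 \<le> g i x}"
    and h_poly: "\<forall>i\<in>{1..m}. real_polynomial_function (h i)"
    and boundary_eq: "domain_boundary \<Omega> = insert 0 {x. (\<Prod>i=1..m. h i x) = 0}"
    and f_poly: "\<forall>i. real_polynomial_function (\<lambda>x. f x $ i)"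
    and G_poly: "\<forall>i j. real_polynomial_function (\<lambda>x. G x $ i $ j)"
    and B_poly: "\<forall>i j. real_polynomial_function (\<lambda>x. B x $ i $ j)"
    and vanish_at_zero: "f 0 = 0" "G 0 = 0" "B 0 = 0"
    and noise: "brownian_motion M W S"
    and R_pos_def: "pos_def_matrix R"
    and q_poly: "real_polynomial_function q"
    and q_pos_def: "pos_def_on \<Omega> q"
    and phi_poly: "real_polynomial_function \<phi>"
    and phi_pos_def: "pos_def_on \<Omega> \<phi>"
    and lam_pos: "0 < lam"
    and noise_control: "\<forall>x\<in>\<Omega>. lam *\<^sub>R (G x ** matrix_inv R ** transpose (G x))
                             = B x ** S ** transpose (B x)"
    and solution: "solves_P \<Omega> f B S q \<phi> lam (\<Psi>l, \<Psi>u, \<epsilon>)"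
    and Psi_l_pos: "\<forall>x\<in>\<Omega>. 0 < \<Psi>l x"
  shows "SCLF \<Omega> f G B S (\<lambda>x t. - lam * ln (\<Psi>l x))"
proof -
  let ?V = "\<lambda>x. - lam * ln (\<Psi>l x)"
  have "feasible \<Omega> f B S q \<phi> lam (\<Psi>l, \<Psi>u, \<epsilon>)"
    using solution by (simp add: solves_P_def is_arg_min_def)
  then have poly: "real_polynomial_function \<Psi>l"
    and sub: "\<And>x. x \<in> \<Omega> \<Longrightarrow> 1 / lam * q x * \<Psi>l x \<le> linear_HJB_op f B S \<Psi>l x"
    and bd: "\<And>x. x \<in> domain_boundary \<Omega> \<Longrightarrow> \<Psi>l x \<le> exp (- \<phi> x / lam)"
    and at0: "\<Psi>l 0 = 1"
    by (auto simp: feasible_def)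
  note cont = continuous_on_real_polynomial_function[OF poly]
  have lt1: "\<Psi>l x < 1" if x: "x \<in> \<Omega> - {0}" for x
  proof (rule ccontr)
    assume "\<not> \<Psi>l x < 1"
    obtain z where z: "z \<in> \<Omega>" "\<And>y. y \<in> \<Omega> \<Longrightarrow> \<Psi>l y \<le> \<Psi>l z"
      using continuous_attains_sup[OF compact_domain _ cont] zero_in_domain by blast
    \<comment> \<open>The maximizer must avoid the origin, where \<open>q\<close> and
      \<open>\<phi>\<close> vanish and give no strict inequality. If the maximum is attained at the
      origin, its value is 1, so the supposed point \<open>x\<close> with
      \<open>\<Psi>l x \<ge> 1\<close> is a maximizer as well.\<close>
    obtain y where y: "y \<in> \<Omega> - {0}" "\<And>w. w \<in> \<Omega> \<Longrightarrow> \<Psi>l w \<le> \<Psi>l y"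
    proof (cases "z = 0")
      case True
      then show ?thesis
        using that[OF x] z(2) at0 \<open>\<not> \<Psi>l x < 1\<close> by fastforce
    next
      case False
      then show ?thesis using that[of z] z by blast
    qed
    have "1 \<le> \<Psi>l y" using y(2)[OF zero_in_domain] at0 by simp
    have "y \<in> interior \<Omega>"
    proof (rule ccontr)
      assume "y \<notin> interior \<Omega>"
      then have "y \<in> domain_boundary \<Omega>"
        using y(1) closure_subset[of \<Omega>] by (auto simp: domain_boundary_def frontier_def)
      moreover have "exp (- \<phi> y / lam) < 1"
        using phi_pos_def y(1) lam_pos by (simp add: pos_def_on_def del: minus_divide_left)
      ultimately show False using bd[of y] \<open>1 \<le> \<Psi>l y\<close> by linarith
    qed
    then have "linear_HJB_op f B S \<Psi>l y \<le> 0"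
      using y(2)
      by (rule linear_HJB_op_nonpos_at_interior_max[OF poly brownian_motion_pos_semidef[OF noise]])
    moreover have "0 < 1 / lam * q y * \<Psi>l y"
      using q_pos_def y(1) lam_pos \<open>1 \<le> \<Psi>l y\<close> by (simp add: pos_def_on_def)
    ultimately show False using sub[of y] y(1) by simp
  qed
  have pd: "pos_def_on \<Omega> ?V"
    using lt1 Psi_l_pos lam_pos at0 by (auto simp: pos_def_on_def mult_pos_neg)
  have "continuous_on \<Omega> ?V"
    using Psi_l_pos by (intro continuous_intros cont) auto
  from class_K_lower_bound[OF compact_domain zero_in_domain this pd]
  have "\<exists>\<mu>\<in>class_K. \<forall>x\<in>insert 0 \<Omega>. \<forall>t>0::real. \<mu> (norm x) \<le> ?V x"
    using zero_in_domain by (simp add: insert_absorb) blast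
  moreover have "\<exists>u. \<forall>x\<in>\<Omega> - {0}. \<forall>t>0. generator f G B S u (\<lambda>x t. ?V x) x t \<le> 0"
  proof (intro exI ballI allI impI)
    fix x t assume x: "x \<in> \<Omega> - {0}"
    \<comment> \<open>Feasibility bounds the generator by \<open>- q x\<close>; only the sign of
      this bound is kept.\<close>
    have "0 \<le> q x" using q_pos_def x by (auto simp: pos_def_on_def less_imp_le)
    then have "0 \<le> 1 / lam * q x * \<Psi>l x"
      using Psi_l_pos x lam_pos by (simp add: less_imp_le)
    then have "0 \<le> linear_HJB_op f B S \<Psi>l x" using sub[of x] x by simp
    then have "- lam / \<Psi>l x * linear_HJB_op f B S \<Psi>l x \<le> 0"
      using Psi_l_pos x lam_pos by (simp add: less_imp_le)
    \<comment> \<open>This fixes the witness for \<open>u\<close>: the feedback of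
      \<open>generator_log_transform\<close> with \<open>matrix_inv R\<close> for
      \<open>K\<close>.\<close>
    then show "generator f G B S
      (\<lambda>x t. (lam / (2 * \<Psi>l x)) *\<^sub>R (matrix_inv R *v (transpose (G x) *v gradient \<Psi>l x)))
      (\<lambda>x t. ?V x) x t \<le> 0"
      using generator_log_transform[OF poly, of x lam G "matrix_inv R" B S f t]
        Psi_l_pos x lam_pos noise_control by auto
  qed
  moreover have "C21_on (insert 0 \<Omega>) (\<lambda>x t. ?V x)"
    using Psi_l_pos zero_in_domain by (intro C21_on_log_transform[OF poly]) auto
  ultimately show ?thesis
    using pd by (simp add: SCLF_def)
qed

end
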